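(* Let $\alpha>0$, let $(J_n)_{n\ge1}$ be an $\alpha$-kernel, $J=\sum_{n\ge1}J_n$, and $(\mathscr{L}f)_n=\sum_{m\ne n}J_{|n-m|}(f_n-f_m)$. Let $\rho\mapsto Q(\rho)\in l^2(\mathbb{Z};\mathbb{R})$ be the $C^1$-curve of onsite stationary solutions, $(I+\rho\mathscr{L})Q(\rho)-Q(\rho)^3=0$, with $Q(0)=\delta_0$, given by the implicit function theorem. With $\rho=\epsilon/\omega_A$, let $Q^{(\rho)}=\omega_A^{-1/2}(q_n)_{n\in\mathbb{Z}}$ where $$q_0=\sqrt{\omega_A+2\epsilon J},\qquad q_n=\frac{\epsilon\left(J_nq_0+\sum_{m=1}^{n-1}(J_{n-m}+J_{n+m})q_m\right)}{\epsilon(2J-J_{2n})+\omega_A}\quad(n\ge1),\qquad q_{-n}=q_n .$$ Let $u(t)$ be the solution of $i\dot u_n=\rho(\mathscr{L}u)_n-|u_n|^2u_n$ with $u(0)=Q^{(\rho)}$. Then for any $\epsilon'>0$ there exists $c_0=c_0(\epsilon')>0$ such that if $0\le\rho<\frac{c_0}{J}$, then $$\sup_{t\in\mathbb{R}}\ \inf_{\theta\in\mathbb{R}}\|u(t)-e^{i\theta}Q(\rho)\|_{l^2}<\epsilon' .$$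
   Context: For $0<\alpha<\infty$, an $\alpha$-kernel is a sequence $J_n\ge0$ ($n\ge1$), not identically zero, with $\lim_{n\to\infty}n^{1+\alpha}J_n\in(0,\infty)$. $\delta_0$ is the Kronecker delta sequence at site $0$; $Q^3$ is the pointwise cube. $Q^{(\rho)}$ depends on $(\epsilon,\omega_A)$ only through $\rho$ (and equals $\delta_0$ at $\rho=0$). The evolution equation is the rescaling of $i\dot u_n=\epsilon(\mathscr{L}u)_n-|u_n|^2u_n$ by $u\mapsto\sqrt{\omega_A}\,u$ and $t\mapsto\omega_At$, for which $e^{it}Q(\rho)$ is a standing wave; it is globally well-posed in $l^2(\mathbb{Z};\mathbb{C})$. The range of $\rho$ is contained in $0\le\rho<\frac{1}{16J}$ (shrinking $c_0$ if necessary). *)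

theory Defs
  imports "HOL-Analysis.Analysis"
begin

definition sq_summable :: "(int \<Rightarrow> 'a::real_normed_vector) \<Rightarrow> bool" where
  "sq_summable f \<longleftrightarrow> (\<lambda>n. (norm (f n))\<^sup>2) summable_on UNIV"

definition seq_norm :: "(int \<Rightarrow> 'a::real_normed_vector) \<Rightarrow> real" where
  "seq_norm f = sqrt (\<Sum>\<^sub>\<infinity>n. (norm (f n))\<^sup>2)"

lemma L2_set_le_seq_norm:
  assumes "sq_summable f" "finite F"
  shows "L2_set (\<lambda>n. norm (f n)) F \<le> seq_norm f"
  unfolding L2_set_def seq_norm_def
  using assms by (auto simp: sq_summable_def intro!: finite_sum_le_infsum)

lemma sq_summable_and_norm_le:
  assumes "\<And>F. finite F \<Longrightarrow> L2_set (\<lambda>n. norm (f n)) F \<le> B"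
  shows "sq_summable f" "seq_norm f \<le> B"
proof -
  have B: "0 \<le> B" using assms[of "{}"] by simp
  have le: "(\<Sum>n\<in>F. (norm (f n))\<^sup>2) \<le> B\<^sup>2" if "finite F" for F
    using assms[OF that] B unfolding L2_set_def
    by (meson real_sqrt_le_iff real_le_lsqrt sqrt_le_D)
  show s: "sq_summable f" unfolding sq_summable_def
    by (rule nonneg_bdd_above_summable_on) (auto intro!: bdd_aboveI2[where M="B\<^sup>2"] le)
  have "(\<Sum>\<^sub>\<infinity>n. (norm (f n))\<^sup>2) \<le> B\<^sup>2"
    using s le unfolding sq_summable_def by (intro infsum_le_finite_sums) auto
  then show "seq_norm f \<le> B" unfolding seq_norm_def
    using B by (simp add: real_le_lsqrt)
qed

lemma L2_set_add_le:
  assumes "sq_summable f" "sq_summable g" "finite F"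
  shows "L2_set (\<lambda>n. norm (f n + g n)) F \<le> seq_norm f + seq_norm g"
proof -
  have "L2_set (\<lambda>n. norm (f n + g n)) F \<le> L2_set (\<lambda>n. norm (f n) + norm (g n)) F"
    by (rule L2_set_mono) (auto intro: norm_triangle_ineq)
  also have "\<dots> \<le> L2_set (\<lambda>n. norm (f n)) F + L2_set (\<lambda>n. norm (g n)) F"
    by (rule L2_set_triangle_ineq)
  also have "\<dots> \<le> seq_norm f + seq_norm g"
    using assms by (intro add_mono L2_set_le_seq_norm)
  finally show ?thesis .
qed

lemma sq_summable_add: "sq_summable f \<Longrightarrow> sq_summable g \<Longrightarrow> sq_summable (\<lambda>n. f n + g n)"
  by (rule sq_summable_and_norm_le(1)[OF L2_set_add_le])

lemma seq_norm_add:
  "sq_summable f \<Longrightarrow> sq_summable g \<Longrightarrow> seq_norm (\<lambda>n. f n + g n) \<le> seq_norm f + seq_norm g"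
  by (rule sq_summable_and_norm_le(2)[OF L2_set_add_le])

lemma sq_summable_scaleR: "sq_summable f \<Longrightarrow> sq_summable (\<lambda>n. c *\<^sub>R f n)"
  by (simp add: sq_summable_def power_mult_distrib summable_on_cmult_right)

lemma seq_norm_scaleR: "seq_norm (\<lambda>n. c *\<^sub>R f n) = \<bar>c\<bar> * seq_norm f"
  by (simp add: seq_norm_def power_mult_distrib infsum_cmult_right' real_sqrt_mult)

lemma sq_summable_uminus: "sq_summable f \<Longrightarrow> sq_summable (\<lambda>n. - f n)"
  by (simp add: sq_summable_def)

lemma sq_summable_diff: "sq_summable f \<Longrightarrow> sq_summable g \<Longrightarrow> sq_summable (\<lambda>n. f n - g n)"
  using sq_summable_add[OF _ sq_summable_uminus] by fastforce

lemma seq_norm_eq_0: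
  assumes "sq_summable f"
  shows "seq_norm f = 0 \<longleftrightarrow> f = (\<lambda>_. 0)"
proof
  assume *: "seq_norm f = 0"
  show "f = (\<lambda>_. 0)"
    using L2_set_le_seq_norm[OF assms, of "{n}" for n] * by (auto simp: L2_set_def)
qed (simp add: seq_norm_def)

typedef (overloaded) 'a ell2 = "{f :: int \<Rightarrow> 'a::real_normed_vector. sq_summable f}"
  morphisms site Abs_ell2
  by (rule exI[of _ "\<lambda>_. 0"]) (simp add: sq_summable_def)

setup_lifting type_definition_ell2

instantiation ell2 :: (real_normed_vector) real_normed_vector
begin

lift_definition zero_ell2 :: "'a ell2" is "\<lambda>_. 0"
  by (simp add: sq_summable_def)

lift_definition plus_ell2 :: "'a ell2 \<Rightarrow> 'a ell2 \<Rightarrow> 'a ell2" is "\<lambda>f g n. f n + g n"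
  by (rule sq_summable_add)

lift_definition minus_ell2 :: "'a ell2 \<Rightarrow> 'a ell2 \<Rightarrow> 'a ell2" is "\<lambda>f g n. f n - g n"
  by (rule sq_summable_diff)

lift_definition uminus_ell2 :: "'a ell2 \<Rightarrow> 'a ell2" is "\<lambda>f n. - f n"
  by (rule sq_summable_uminus)

lift_definition scaleR_ell2 :: "real \<Rightarrow> 'a ell2 \<Rightarrow> 'a ell2" is "\<lambda>c f n. c *\<^sub>R f n"
  by (rule sq_summable_scaleR)

lift_definition norm_ell2 :: "'a ell2 \<Rightarrow> real" is seq_norm .

definition sgn_ell2 :: "'a ell2 \<Rightarrow> 'a ell2" where
  "sgn_ell2 x = inverse (norm x) *\<^sub>R x"

definition dist_ell2 :: "'a ell2 \<Rightarrow> 'a ell2 \<Rightarrow> real" where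
  "dist_ell2 x y = norm (x - y)"

definition uniformity_ell2 :: "('a ell2 \<times> 'a ell2) filter" where
  "uniformity_ell2 = (INF e\<in>{0<..}. principal {(x, y). dist x y < e})"

definition open_ell2 :: "'a ell2 set \<Rightarrow> bool" where
  "open_ell2 S = (\<forall>x\<in>S. \<forall>\<^sub>F (x', y) in uniformity. x' = x \<longrightarrow> y \<in> S)"

instance
proof
  fix x y z :: "'a ell2" and a b :: real
  show "x + y + z = x + (y + z)" by transfer (simp add: add.assoc)
  show "x + y = y + x" by transfer (simp add: add.commute)
  show "0 + x = x" by transfer simp
  show "- x + x = 0" by transfer simp
  show "x - y = x + - y" by transfer simp
  show "a *\<^sub>R (x + y) = a *\<^sub>R x + a *\<^sub>R y" by transfer (simp add: scaleR_add_right)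
  show "(a + b) *\<^sub>R x = a *\<^sub>R x + b *\<^sub>R x" by transfer (simp add: scaleR_add_left)
  show "a *\<^sub>R b *\<^sub>R x = (a * b) *\<^sub>R x" by transfer simp
  show "1 *\<^sub>R x = x" by transfer simp
  show "norm x = 0 \<longleftrightarrow> x = 0" by transfer (rule seq_norm_eq_0)
  show "norm (x + y) \<le> norm x + norm y" by transfer (rule seq_norm_add)
  show "norm (a *\<^sub>R x) = \<bar>a\<bar> * norm x" by transfer (rule seq_norm_scaleR)
qed (rule sgn_ell2_def dist_ell2_def uniformity_ell2_def open_ell2_def)+

end

text \<open>Kernels are indexed by positive integers; the value at \<open>0\<close> is never used.\<close>

definition alpha_kernel :: "real \<Rightarrow> (nat \<Rightarrow> real) \<Rightarrow> bool" where
  "alpha_kernel \<alpha> J \<longleftrightarrow>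
     0 < \<alpha> \<and>
     (\<forall>n\<ge>1. 0 \<le> J n) \<and>
     (\<exists>n\<ge>1. J n \<noteq> 0) \<and>
     (\<exists>l>0. (\<lambda>n. real n powr (1 + \<alpha>) * J n) \<longlonglongrightarrow> l)"

definition total_mass :: "(nat \<Rightarrow> real) \<Rightarrow> real" where
  "total_mass J = (\<Sum>\<^sub>\<infinity>n\<in>{1..}. J n)"

definition nonlocal_op :: "(nat \<Rightarrow> real) \<Rightarrow> (int \<Rightarrow> 'a::real_normed_vector) \<Rightarrow> int \<Rightarrow> 'a" where
  "nonlocal_op J f n = (\<Sum>\<^sub>\<infinity>m\<in>-{n}. J (nat \<bar>n - m\<bar>) *\<^sub>R (f n - f m))"

text \<open>
  The branch of onsite stationary solutions for \<open>0 \<le> \<rho> < r\<close>: a continuously differentiable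
  curve in the \<open>\<ell>\<^sup>2\<close> norm (one-sided derivative at \<open>\<rho> = 0\<close>) that solves the stationary equation and
  starts at the Kronecker delta. By the uniqueness part of the implicit function
  theorem, these conditions determine the curve near \<open>\<rho> = 0\<close>.
\<close>

definition onsite_curve :: "(nat \<Rightarrow> real) \<Rightarrow> real \<Rightarrow> (real \<Rightarrow> real ell2) \<Rightarrow> bool" where
  "onsite_curve J r Q \<longleftrightarrow>
     (\<exists>Q'. (\<forall>\<rho>\<in>{0..<r}. (Q has_vector_derivative Q' \<rho>) (at \<rho> within {0..<r})) \<and>
           continuous_on {0..<r} Q') \<and>
     (\<forall>n. site (Q 0) n = (if n = 0 then 1 else 0)) \<and>
     (\<forall>\<rho>\<in>{0..<r}. \<forall>n.
        site (Q \<rho>) n + \<rho> * nonlocal_op J (site (Q \<rho>)) n - (site (Q \<rho>) n) ^ 3 = 0)"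

text \<open>
  For \<open>n \<ge> 1\<close> the stationary equation is solved for its linear terms at site \<open>n\<close>, keeping among
  the other sites only those \<open>m\<close> with \<open>\<bar>m\<bar> < n\<close> and the mirror site \<open>-n\<close> and dropping the cubic term.
\<close>

fun q_rec :: "(nat \<Rightarrow> real) \<Rightarrow> real \<Rightarrow> real \<Rightarrow> nat \<Rightarrow> real" where
  "q_rec J \<epsilon> \<omega> n =
     (if n = 0 then sqrt (\<omega> + 2 * \<epsilon> * total_mass J)
      else \<epsilon> * (J n * q_rec J \<epsilon> \<omega> 0 + (\<Sum>m = 1..<n. (J (n - m) + J (n + m)) * q_rec J \<epsilon> \<omega> m))
           / (\<epsilon> * (2 * total_mass J - J (2 * n)) + \<omega>))"

declare q_rec.simps [simp del]

definition approx_profile :: "(nat \<Rightarrow> real) \<Rightarrow> real \<Rightarrow> real \<Rightarrow> int \<Rightarrow> real" where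
  "approx_profile J \<epsilon> \<omega> n = \<omega> powr (- 1 / 2) * q_rec J \<epsilon> \<omega> (nat \<bar>n\<bar>)"

text \<open>The time derivative is taken in the \<open>\<ell>\<^sup>2\<close> norm.\<close>

definition dnls_solution :: "(nat \<Rightarrow> real) \<Rightarrow> real \<Rightarrow> (real \<Rightarrow> complex ell2) \<Rightarrow> bool" where
  "dnls_solution J \<rho> u \<longleftrightarrow>
     (\<forall>t. \<exists>v. (u has_vector_derivative v) (at t) \<and>
        (\<forall>n. \<i> * site v n =
               complex_of_real \<rho> * nonlocal_op J (site (u t)) n
               - complex_of_real ((cmod (site (u t) n))\<^sup>2) * site (u t) n))"

lift_definition rotate_phase :: "real \<Rightarrow> real ell2 \<Rightarrow> complex ell2"
  is "\<lambda>\<theta> f n. exp (\<i> * complex_of_real \<theta>) * complex_of_real (f n)"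
  by (simp add: sq_summable_def norm_mult)

end

theory Submission
  imports Defs
begin

text \<open>
  Put \<open>c = \<rho> J\<close>; the operator \<open>\<rho> L\<close> has norm at most \<open>4 c\<close>. Stability is obtained without any
  coercivity of the linearization. Along the flow the quantities \<open>N = \<parallel>u\<parallel>\<^sup>2\<close> and
  \<open>2 \<rho> \<langle>Lu, u\<rangle> - \<Sum> \<bar>u\<^sub>n\<bar>\<^sup>4\<close> are conserved, hence \<open>\<Sum> \<bar>u\<^sub>n\<bar>\<^sup>4\<close> varies by at most \<open>16 c N\<close>, and it is
  close to \<open>N\<^sup>2\<close> at time \<open>0\<close>. With \<open>X = \<bar>u\<^sub>0\<bar>\<^sup>2\<close> and \<open>Y = N - X\<close> one has \<open>\<Sum> \<bar>u\<^sub>n\<bar>\<^sup>4 \<le> X\<^sup>2 + Y\<^sup>2 = N\<^sup>2 - 2 X Y\<close>,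
  so \<open>X Y = O(c)\<close> for all time. Thus \<open>X\<close> cannot cross \<open>N / 2\<close>, and by continuity \<open>Y = O(c)\<close>, i.e. the
  solution stays near the circle \<open>e\<^sup>i\<^sup>\<theta> \<delta>\<^sub>0\<close>. The stationary solution and the approximate profile are
  within \<open>O(c)\<close> of \<open>\<delta>\<^sub>0\<close> as well.
\<close>

subsection \<open>Square-summable sequences\<close>

lemma sq_summable_site: "(\<lambda>n. (norm (site f n))\<^sup>2) summable_on UNIV"
  using site[of f] by (simp add: sq_summable_def)

lemma norm_ell2_power2: "(norm f)\<^sup>2 = (\<Sum>\<^sub>\<infinity>n. (norm (site f n))\<^sup>2)"
  by (simp add: norm_ell2.rep_eq seq_norm_def infsum_nonneg)

lemma norm_site_le: "norm (site f n) \<le> norm f"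
  using L2_set_le_seq_norm[of "site f" "{n}"] site[of f] by (simp add: norm_ell2.rep_eq)

lemma norm_ell2_mono:
  assumes "\<And>n. norm (site f n) \<le> norm (site g n)"
  shows "norm f \<le> norm g"
proof -
  have "(norm f)\<^sup>2 \<le> (norm g)\<^sup>2"
    unfolding norm_ell2_power2
    by (rule infsum_mono[OF sq_summable_site sq_summable_site]) (simp add: power_mono assms)
  then show ?thesis by (rule power2_le_imp_le) simp
qed

lemma ell2_eqI: "(\<And>n. site f n = site g n) \<Longrightarrow> f = g"
  by (metis ext site_inject)

lemma sq_summable_mono:
  assumes "sq_summable g" "\<And>n. norm (f n) \<le> norm (g n)"
  shows "sq_summable f"
  unfolding sq_summable_def
  by (rule summable_on_comparison_test[OF assms(1)[unfolded sq_summable_def]])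
     (auto intro: power_mono assms)

lemma norm_mult_summable:
  assumes "sq_summable f" "sq_summable g"
  shows "(\<lambda>n. norm (f n) * norm (g n)) summable_on UNIV"
proof (rule summable_on_comparison_test)
  show "(\<lambda>n. (norm (f n))\<^sup>2 + (norm (g n))\<^sup>2) summable_on UNIV"
    using assms by (simp add: sq_summable_def summable_on_add)
  show "norm (f n) * norm (g n) \<le> (norm (f n))\<^sup>2 + (norm (g n))\<^sup>2" for n
    using sum_squares_bound[of "norm (f n)" "norm (g n)"]
      mult_nonneg_nonneg[OF norm_ge_zero[of "f n"] norm_ge_zero[of "g n"]] by linarith
qed auto

lemma inner_summable:
  fixes f g :: "int \<Rightarrow> 'a::real_inner"
  assumes "sq_summable f" "sq_summable g"
  shows "(\<lambda>n. inner (f n) (g n)) summable_on UNIV"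
  by (rule abs_summable_summable,
      rule Infinite_Sum.abs_summable_on_comparison_test'[OF norm_mult_summable[OF assms]])
     (simp add: Cauchy_Schwarz_ineq2)

text \<open>For complex sequences this is the real part of the Hermitian product. Multiplication by
  i is then antisymmetric, and conserved quantities can be differentiated by the product rule for
  \<open>inner\<close>.\<close>

instantiation ell2 :: (real_inner) real_inner
begin

lift_definition inner_ell2 :: "'a ell2 \<Rightarrow> 'a ell2 \<Rightarrow> real"
  is "\<lambda>f g. \<Sum>\<^sub>\<infinity>n. inner (f n) (g n)" .

instance
proof
  fix x y z :: "'a ell2" and r :: real
  show "inner x y = inner y x"
    by transfer (simp add: inner_commute)
  show "inner (x + y) z = inner x z + inner y z"
    by transfer (simp add: inner_add_left infsum_add inner_summable)
  show "inner (r *\<^sub>R x) y = r * inner x y"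
    by transfer (simp add: infsum_cmult_right')
  show nonneg: "0 \<le> inner x x"
    by transfer (simp add: infsum_nonneg)
  show norm: "norm x = sqrt (inner x x)"
    by transfer (simp add: seq_norm_def power2_norm_eq_inner)
  show "inner x x = 0 \<longleftrightarrow> x = 0"
    using nonneg norm by (metis norm_eq_zero real_sqrt_eq_zero_cancel_iff)
qed

end

lemma infsum_Cauchy_Schwarz:
  fixes a b :: "int \<Rightarrow> real"
  assumes "sq_summable a" "sq_summable b"
  shows "(\<Sum>\<^sub>\<infinity>n. a n * b n)\<^sup>2 \<le> (\<Sum>\<^sub>\<infinity>n. (a n)\<^sup>2) * (\<Sum>\<^sub>\<infinity>n. (b n)\<^sup>2)"
  using Cauchy_Schwarz_ineq[of "Abs_ell2 a" "Abs_ell2 b"] assms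
  by (simp add: inner_ell2.rep_eq Abs_ell2_inverse power2_eq_square)

section \<open>Splitting off the central site, and pointwise products\<close>

lift_definition delta0 :: "'a \<Rightarrow> 'a::real_normed_vector ell2" is "\<lambda>z n. if n = 0 then z else 0"
proof -
  fix z :: 'a
  have "(\<lambda>n::int. (norm (if n = 0 then z else 0))\<^sup>2) summable_on UNIV \<longleftrightarrow>
      (\<lambda>n. (norm (if n = 0 then z else 0))\<^sup>2) summable_on {0::int}"
    by (rule summable_on_cong_neutral) auto
  then show "sq_summable (\<lambda>n. if n = 0 then z else 0)"
    by (simp add: sq_summable_def)
qed

lemma norm_delta0 [simp]: "norm (delta0 z) = norm z"
proof -
  have "(norm (delta0 z))\<^sup>2 = (\<Sum>\<^sub>\<infinity>n\<in>{0}. (norm (site (delta0 z) n))\<^sup>2)"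
    unfolding norm_ell2_power2 by (rule infsum_cong_neutral) (auto simp: delta0.rep_eq)
  then show ?thesis by (simp add: delta0.rep_eq)
qed

definition off0 :: "'a::real_normed_vector ell2 \<Rightarrow> 'a ell2" where
  "off0 f = f - delta0 (site f 0)"

lemma site_off0: "site (off0 f) n = (if n = 0 then 0 else site f n)"
  by (simp add: off0_def minus_ell2.rep_eq delta0.rep_eq)

lemma norm_split_site0: "(norm f)\<^sup>2 = (norm (site f 0))\<^sup>2 + (norm (off0 f))\<^sup>2"
proof -
  have s: "(\<lambda>n. (norm (site f n))\<^sup>2) summable_on -{0}"
    by (rule summable_on_subset[OF sq_summable_site]) auto
  have "(norm f)\<^sup>2 = (\<Sum>\<^sub>\<infinity>n\<in>insert 0 (-{0}). (norm (site f n))\<^sup>2)"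
    unfolding norm_ell2_power2 by (rule infsum_cong_neutral) auto
  also have "\<dots> = (norm (site f 0))\<^sup>2 + (\<Sum>\<^sub>\<infinity>n\<in>-{0}. (norm (site f n))\<^sup>2)"
    by (rule infsum_insert[OF s]) auto
  also have "(\<Sum>\<^sub>\<infinity>n\<in>-{0}. (norm (site f n))\<^sup>2) = (norm (off0 f))\<^sup>2"
    unfolding norm_ell2_power2 by (rule infsum_cong_neutral) (auto simp: site_off0)
  finally show ?thesis .
qed

text \<open>\<open>pointwise_inner f f\<close> is the sequence of squared moduli, so its squared
  norm is the quartic sum. As an \<open>ell2\<close>-valued bilinear map it makes that sum
  differentiable along the flow. The product stays in l2 because an l2 sequence is bounded.\<close>

lift_definition pointwise_inner :: "'a::real_inner ell2 \<Rightarrow> 'a ell2 \<Rightarrow> real ell2"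
  is "\<lambda>f g n. inner (f n) (g n)"
proof -
  fix f g :: "int \<Rightarrow> 'a"
  assume f: "sq_summable f" and g: "sq_summable g"
  show "sq_summable (\<lambda>n. inner (f n) (g n))"
  proof (rule sq_summable_mono)
    show "sq_summable (\<lambda>n. seq_norm f *\<^sub>R g n)"
      by (rule sq_summable_scaleR[OF g])
    show "norm (inner (f n) (g n)) \<le> norm (seq_norm f *\<^sub>R g n)" for n
    proof -
      have "norm (f n) \<le> seq_norm f"
        using L2_set_le_seq_norm[OF f, of "{n}"] by simp
      then have "norm (f n) * norm (g n) \<le> \<bar>seq_norm f\<bar> * norm (g n)"
        by (intro mult_right_mono) auto
      then show ?thesis
        using Cauchy_Schwarz_ineq2[of "f n" "g n"] by simp
    qed
  qed
qed

lemma norm_pointwise_inner_le: "norm (pointwise_inner f g) \<le> norm f * norm g"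
proof -
  have "norm (pointwise_inner f g) \<le> norm (norm f *\<^sub>R g)"
  proof (rule norm_ell2_mono)
    fix n
    have "norm (site f n) * norm (site g n) \<le> norm f * norm (site g n)"
      by (intro mult_right_mono norm_site_le) auto
    then show "norm (site (pointwise_inner f g) n) \<le> norm (site (norm f *\<^sub>R g) n)"
      using Cauchy_Schwarz_ineq2[of "site f n" "site g n"]
      by (simp add: pointwise_inner.rep_eq scaleR_ell2.rep_eq)
  qed
  then show ?thesis by simp
qed

lemma bounded_bilinear_pointwise_inner: "bounded_bilinear pointwise_inner"
proof
  fix a a' b b' :: "'a ell2" and r :: real
  show "pointwise_inner (a + a') b = pointwise_inner a b + pointwise_inner a' b"
    by (rule ell2_eqI) (simp add: pointwise_inner.rep_eq plus_ell2.rep_eq inner_add_left)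
  show "pointwise_inner a (b + b') = pointwise_inner a b + pointwise_inner a b'"
    by (rule ell2_eqI) (simp add: pointwise_inner.rep_eq plus_ell2.rep_eq inner_add_right)
  show "pointwise_inner (r *\<^sub>R a) b = r *\<^sub>R pointwise_inner a b"
    by (rule ell2_eqI) (simp add: pointwise_inner.rep_eq scaleR_ell2.rep_eq)
  show "pointwise_inner a (r *\<^sub>R b) = r *\<^sub>R pointwise_inner a b"
    by (rule ell2_eqI) (simp add: pointwise_inner.rep_eq scaleR_ell2.rep_eq)
  show "\<exists>K. \<forall>a b :: 'a ell2. norm (pointwise_inner a b) \<le> norm a * norm b * K"
    by (rule exI[of _ 1]) (simp add: norm_pointwise_inner_le)
qed

lemma off0_pointwise_inner: "off0 (pointwise_inner f f) = pointwise_inner (off0 f) (off0 f)"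
  by (rule ell2_eqI) (simp add: site_off0 pointwise_inner.rep_eq)

text \<open>The contribution of the central site is exact; away from it the l4 norm is at most the
  l2 norm.\<close>

lemma norm_pointwise_inner_split_le:
  "(norm (pointwise_inner f f))\<^sup>2 \<le> ((norm (site f 0))\<^sup>2)\<^sup>2 + ((norm (off0 f))\<^sup>2)\<^sup>2"
proof -
  have "norm (pointwise_inner (off0 f) (off0 f)) \<le> (norm (off0 f))\<^sup>2"
    using norm_pointwise_inner_le[of "off0 f" "off0 f"] by (simp add: power2_eq_square)
  then have "(norm (pointwise_inner (off0 f) (off0 f)))\<^sup>2 \<le> ((norm (off0 f))\<^sup>2)\<^sup>2"
    by (intro power_mono) auto
  then show ?thesis
    using norm_split_site0[of "pointwise_inner f f"]
    by (simp add: off0_pointwise_inner pointwise_inner.rep_eq power2_norm_eq_inner)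
qed

subsection \<open>The nonlocal operator\<close>

locale summable_kernel =
  fixes J :: "nat \<Rightarrow> real"
  assumes nonneg: "1 \<le> n \<Longrightarrow> 0 \<le> J n"
    and summable: "J summable_on {1..}"
begin

abbreviation mass :: real where "mass \<equiv> total_mass J"

text \<open>Even extension of \<open>J\<close> to the integers. The value 0 at the origin lets sums
  over \<open>m \<noteq> n\<close> run over all integers and keeps \<open>J 0\<close> out of
  them.\<close>

definition even_kernel :: "int \<Rightarrow> real" where
  "even_kernel j = (if j = 0 then 0 else J (nat \<bar>j\<bar>))"

lemma mass_nonneg: "0 \<le> mass"
  unfolding total_mass_def by (rule infsum_nonneg) (auto intro: nonneg)

lemma even_kernel_nonneg: "0 \<le> even_kernel j"
  by (auto simp: even_kernel_def intro: nonneg)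

lemma even_kernel_commute: "even_kernel (n - m) = even_kernel (m - n)"
  by (simp add: even_kernel_def abs_minus_commute)

lemma even_kernel_has_sum: "(even_kernel has_sum 2 * mass) UNIV"
proof -
  have J: "(J has_sum mass) {1..}"
    using summable by (simp add: total_mass_def)
  have pos: "(even_kernel has_sum mass) {1..}"
    by (subst has_sum_reindex_bij_witness[where i = int and j = nat and T = "{1..}" and h = J and s' = mass])
       (auto simp: even_kernel_def J[simplified])
  have neg: "(even_kernel has_sum mass) {..-1}"
    by (subst has_sum_reindex_bij_witness[where i = "\<lambda>j. - int j" and j = "\<lambda>j. nat (- j)"
          and T = "{1..}" and h = J and s' = mass])
       (auto simp: even_kernel_def J[simplified])
  have "(even_kernel has_sum (mass + mass)) ({1..} \<union> {..-1})"
    by (rule has_sum_Un_disjoint[OF pos neg]) auto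
  then have "(even_kernel has_sum (mass + mass)) UNIV"
    by (rule has_sum_cong_neutral[THEN iffD1, rotated -1]) (auto simp: even_kernel_def)
  then show ?thesis by simp
qed

lemma even_kernel_translate_has_sum: "((\<lambda>m. even_kernel (n - m)) has_sum 2 * mass) UNIV"
  by (subst has_sum_reindex_bij_witness[where i = "\<lambda>j. n - j" and j = "\<lambda>j. n - j"
        and T = UNIV and h = even_kernel and s' = "2 * mass"]) (auto simp: even_kernel_has_sum)

lemma even_kernel_translate_has_sum': "((\<lambda>n. even_kernel (n - m)) has_sum 2 * mass) UNIV"
  by (subst even_kernel_commute) (rule even_kernel_translate_has_sum)

text \<open>The family is nonnegative and summing over \<open>n\<close> for fixed \<open>m\<close>
  gives \<open>2 * mass * g m\<close>, which is summable in \<open>m\<close>; a swap then restores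
  the order of the indices.\<close>

lemma weighted_summable:
  assumes "g summable_on UNIV" "\<And>m. 0 \<le> g m"
  shows "(\<lambda>(n, m). even_kernel (n - m) * g m) summable_on UNIV \<times> UNIV"
proof -
  have "(\<lambda>(m, n). even_kernel (n - m) * g m) summable_on UNIV \<times> UNIV"
  proof (rule summable_on_SigmaI)
    show "((\<lambda>n. case (m, n) of (m, n) \<Rightarrow> even_kernel (n - m) * g m) has_sum 2 * mass * g m) UNIV" for m
      using has_sum_cmult_left[OF even_kernel_translate_has_sum'[of m], of "g m"] by simp
    show "(\<lambda>m. 2 * mass * g m) summable_on UNIV"
      by (rule summable_on_cmult_right[OF assms(1)])
  qed (auto simp: even_kernel_nonneg assms)
  then show ?thesis
    by (subst summable_on_swap) (simp add: case_prod_unfold)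
qed

lemma weighted_row_summable:
  assumes "g summable_on UNIV" "\<And>m. 0 \<le> g m"
  shows "(\<lambda>n. \<Sum>\<^sub>\<infinity>m. even_kernel (n - m) * g m) summable_on UNIV"
  using summable_on_Sigma_banach[OF weighted_summable[OF assms]] by simp

lemma weighted_infsum:
  assumes "g summable_on UNIV" "\<And>m. 0 \<le> g m"
  shows "(\<Sum>\<^sub>\<infinity>n. \<Sum>\<^sub>\<infinity>m. even_kernel (n - m) * g m) = 2 * mass * infsum g UNIV"
proof -
  have "(\<Sum>\<^sub>\<infinity>n. \<Sum>\<^sub>\<infinity>m. even_kernel (n - m) * g m) = (\<Sum>\<^sub>\<infinity>m. \<Sum>\<^sub>\<infinity>n. even_kernel (n - m) * g m)"
    by (rule infsum_swap_banach[OF weighted_summable[OF assms]])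
  also have "\<dots> = (\<Sum>\<^sub>\<infinity>m. 2 * mass * g m)"
    by (intro infsum_cong infsumI has_sum_cmult_left even_kernel_translate_has_sum')
  finally show ?thesis by (simp add: infsum_cmult_right')
qed

section \<open>Convolution with the kernel as a bounded self-adjoint operator\<close>

lemma convolution_abs_summable:
  fixes f :: "'a::real_normed_vector ell2"
  shows "(\<lambda>m. even_kernel (n - m) *\<^sub>R site f m) abs_summable_on UNIV"
proof (rule Infinite_Sum.abs_summable_on_comparison_test')
  show "(\<lambda>m. even_kernel (n - m) * norm f) summable_on UNIV"
    by (rule summable_on_cmult_left) (rule has_sum_imp_summable[OF even_kernel_translate_has_sum])
qed (simp add: even_kernel_nonneg norm_site_le mult_left_mono)

lemma convolution_has_sum:
  fixes f :: "'a::banach ell2"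
  shows "((\<lambda>m. even_kernel (n - m) *\<^sub>R site f m) has_sum
    (\<Sum>\<^sub>\<infinity>m. even_kernel (n - m) *\<^sub>R site f m)) UNIV"
  by (rule has_sum_infsum[OF abs_summable_summable[OF convolution_abs_summable]])

text \<open>Cauchy-Schwarz with the kernel written as a product of two square roots, only one of
  them grouped with \<open>f\<close>; the other factor has square sum \<open>2 * mass\<close>.
  Summing over \<open>n\<close> later gives Young's inequality for l1 and l2.\<close>

lemma convolution_norm_power2_le:
  fixes f :: "'a::banach ell2"
  shows "(norm (\<Sum>\<^sub>\<infinity>m. even_kernel (n - m) *\<^sub>R site f m))\<^sup>2
    \<le> 2 * mass * (\<Sum>\<^sub>\<infinity>m. even_kernel (n - m) * (norm (site f m))\<^sup>2)"
proof -
  define a where "a m = sqrt (even_kernel (n - m))" for m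
  define b where "b m = a m * norm (site f m)" for m
  have a2: "(a m)\<^sup>2 = even_kernel (n - m)" for m
    by (simp add: a_def even_kernel_nonneg)
  have b2: "(b m)\<^sup>2 = even_kernel (n - m) * (norm (site f m))\<^sup>2" for m
    by (simp add: b_def power_mult_distrib a2)
  have a: "sq_summable a"
    using has_sum_imp_summable[OF even_kernel_translate_has_sum] by (simp add: sq_summable_def a2)
  have "sq_summable (\<lambda>m. norm f *\<^sub>R a m)"
    by (rule sq_summable_scaleR[OF a])
  then have b: "sq_summable b"
    by (rule sq_summable_mono) (simp add: b_def abs_mult norm_site_le mult_left_mono mult.commute[of "norm f"])
  have ab: "a m * b m = norm (even_kernel (n - m) *\<^sub>R site f m)" for m
    by (simp add: b_def even_kernel_nonneg flip: mult.assoc a2 power2_eq_square)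
  have "(norm (\<Sum>\<^sub>\<infinity>m. even_kernel (n - m) *\<^sub>R site f m))\<^sup>2 \<le> (\<Sum>\<^sub>\<infinity>m. a m * b m)\<^sup>2"
    unfolding ab by (intro power_mono norm_infsum_bound convolution_abs_summable) auto
  also have "\<dots> \<le> (\<Sum>\<^sub>\<infinity>m. (a m)\<^sup>2) * (\<Sum>\<^sub>\<infinity>m. (b m)\<^sup>2)"
    by (rule infsum_Cauchy_Schwarz[OF a b])
  also have "(\<Sum>\<^sub>\<infinity>m. (a m)\<^sup>2) = 2 * mass"
    unfolding a2 by (rule infsumI[OF even_kernel_translate_has_sum])
  finally show ?thesis unfolding b2 .
qed

text \<open>\<open>Abs_ell2\<close> is meaningful here only once the sequence is known to be
  square-summable, which is proved in \<open>site_convolution\<close>.\<close>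

definition convolution :: "'a::banach ell2 \<Rightarrow> 'a ell2" where
  "convolution f = Abs_ell2 (\<lambda>n. \<Sum>\<^sub>\<infinity>m. even_kernel (n - m) *\<^sub>R site f m)"

lemma convolution_square_summable:
  "(\<lambda>n. 2 * mass * (\<Sum>\<^sub>\<infinity>m. even_kernel (n - m) * (norm (site f m))\<^sup>2)) summable_on UNIV"
  by (intro summable_on_cmult_right weighted_row_summable sq_summable_site) simp

lemma site_convolution:
  "site (convolution f) n = (\<Sum>\<^sub>\<infinity>m. even_kernel (n - m) *\<^sub>R site f m)"
proof -
  have "sq_summable (\<lambda>n. \<Sum>\<^sub>\<infinity>m. even_kernel (n - m) *\<^sub>R site f m)"
    unfolding sq_summable_def
    by (rule summable_on_comparison_test[OF convolution_square_summable[of f]])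
       (auto intro: convolution_norm_power2_le)
  then show ?thesis by (simp add: convolution_def Abs_ell2_inverse)
qed

lemma norm_convolution_le: "norm (convolution f) \<le> 2 * mass * norm f"
proof (rule power2_le_imp_le)
  have "(norm (convolution f))\<^sup>2
      \<le> (\<Sum>\<^sub>\<infinity>n. 2 * mass * (\<Sum>\<^sub>\<infinity>m. even_kernel (n - m) * (norm (site f m))\<^sup>2))"
    unfolding norm_ell2_power2
    by (rule infsum_mono[OF sq_summable_site convolution_square_summable])
       (simp add: site_convolution convolution_norm_power2_le)
  also have "\<dots> = 2 * mass * (2 * mass * (norm f)\<^sup>2)"
    by (simp add: infsum_cmult_right' weighted_infsum[OF sq_summable_site] norm_ell2_power2)
  finally show "(norm (convolution f))\<^sup>2 \<le> (2 * mass * norm f)\<^sup>2"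
    by (simp add: power2_eq_square mult.assoc mult.left_commute)
qed (simp add: mass_nonneg)

lemma bounded_linear_convolution: "bounded_linear convolution"
proof (rule bounded_linear_intro)
  fix f g :: "'a ell2" and r :: real
  show "convolution (f + g) = convolution f + convolution g"
    by (rule ell2_eqI)
       (simp add: site_convolution plus_ell2.rep_eq scaleR_add_right
         infsum_add[OF has_sum_imp_summable[OF convolution_has_sum] has_sum_imp_summable[OF convolution_has_sum]])
  show "convolution (r *\<^sub>R f) = r *\<^sub>R convolution f"
    by (rule ell2_eqI)
       (simp add: site_convolution scaleR_ell2.rep_eq mult.commute flip: infsum_scaleR_right)
  show "norm (convolution f) \<le> norm f * (2 * mass)"
    using norm_convolution_le[of f] by (simp add: mult.commute)
qed

text \<open>Fubini together with the evenness of the kernel.\<close>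

lemma convolution_self_adjoint:
  fixes f g :: "'a::{real_inner,banach} ell2"
  shows "inner (convolution f) g = inner f (convolution g)"
proof -
  let ?h = "\<lambda>n m. even_kernel (n - m) * inner (site f m) (site g n)"
  \<comment> \<open>The double family is dominated by the kernel times the sum of the squared norms
    of \<open>site f m\<close> and \<open>site g n\<close>. Each part is summable by
    \<open>weighted_summable\<close>, the second after exchanging the indices.\<close>
  have 1: "(\<lambda>(n, m). even_kernel (n - m) * (norm (site f m))\<^sup>2) summable_on UNIV \<times> UNIV"
    by (rule weighted_summable[OF sq_summable_site]) simp
  have "(\<lambda>(n, m). even_kernel (n - m) * (norm (site g m))\<^sup>2) summable_on UNIV \<times> UNIV"
    by (rule weighted_summable[OF sq_summable_site]) simp
  then have 2: "(\<lambda>(n, m). even_kernel (n - m) * (norm (site g n))\<^sup>2) summable_on UNIV \<times> UNIV"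
    by (subst summable_on_swap)
       (simp add: case_prod_unfold even_kernel_commute[of "fst _"])
  have "(\<lambda>(n, m). ?h n m) summable_on UNIV \<times> UNIV"
  proof (rule abs_summable_summable, rule Infinite_Sum.abs_summable_on_comparison_test'[OF summable_on_add[OF 1 2]])
    fix p :: "int \<times> int"
    obtain n m where p: "p = (n, m)" by (cases p)
    have "\<bar>inner (site f m) (site g n)\<bar> \<le> (norm (site f m))\<^sup>2 + (norm (site g n))\<^sup>2"
      using Cauchy_Schwarz_ineq2[of "site f m" "site g n"]
        sum_squares_bound[of "norm (site f m)" "norm (site g n)"]
        mult_nonneg_nonneg[OF norm_ge_zero[of "site f m"] norm_ge_zero[of "site g n"]] by linarith
    then show "norm (case p of (n, m) \<Rightarrow> ?h n m)
        \<le> (case p of (n, m) \<Rightarrow> even_kernel (n - m) * (norm (site f m))\<^sup>2)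
          + (case p of (n, m) \<Rightarrow> even_kernel (n - m) * (norm (site g n))\<^sup>2)"
      by (simp add: p abs_mult even_kernel_nonneg mult_left_mono flip: distrib_left)
  qed
  note swap = infsum_swap_banach[OF this]
  have "inner (convolution f) g = (\<Sum>\<^sub>\<infinity>n. \<Sum>\<^sub>\<infinity>m. ?h n m)"
    unfolding inner_ell2.rep_eq
  proof (rule infsum_cong)
    fix n
    show "inner (site (convolution f) n) (site g n) = (\<Sum>\<^sub>\<infinity>m. ?h n m)"
      using infsumI[OF has_sum_bounded_linear[OF bounded_linear_inner_left[of "site g n"] convolution_has_sum[of n f]]]
      by (simp add: site_convolution)
  qed
  also have "\<dots> = (\<Sum>\<^sub>\<infinity>m. \<Sum>\<^sub>\<infinity>n. ?h n m)" by (rule swap)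
  also have "\<dots> = inner f (convolution g)"
    unfolding inner_ell2.rep_eq
  proof (rule infsum_cong)
    fix m
    show "(\<Sum>\<^sub>\<infinity>n. ?h n m) = inner (site f m) (site (convolution g) m)"
      using infsumI[OF has_sum_bounded_linear[OF bounded_linear_inner_right[of "site f m"] convolution_has_sum[of m g]]]
      by (simp add: site_convolution even_kernel_commute[of m])
  qed
  finally show ?thesis .
qed

text \<open>Every row of the kernel sums to \<open>2 * mass\<close>, so \<open>nonlocal_op\<close>
  is this multiple of the identity minus the convolution. Boundedness and self-adjointness are then
  inherited from \<open>convolution\<close>.\<close>

definition laplacian :: "'a::banach ell2 \<Rightarrow> 'a ell2" where
  "laplacian f = (2 * mass) *\<^sub>R f - convolution f"

lemma site_laplacian: "site (laplacian f) n = nonlocal_op J (site f) n"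
proof -
  have "nonlocal_op J (site f) n = (\<Sum>\<^sub>\<infinity>m. even_kernel (n - m) *\<^sub>R (site f n - site f m))"
    unfolding nonlocal_op_def by (rule infsum_cong_neutral) (auto simp: even_kernel_def)
  also have "\<dots> = (2 * mass) *\<^sub>R site f n + - (\<Sum>\<^sub>\<infinity>m. even_kernel (n - m) *\<^sub>R site f m)"
    using has_sum_add[OF
        has_sum_bounded_linear[OF bounded_linear_scaleR_left even_kernel_translate_has_sum]
        has_sum_bounded_linear[OF bounded_linear_minus[OF bounded_linear_ident] convolution_has_sum]]
    by (intro infsumI) (simp add: scaleR_diff_right)
  finally show ?thesis
    by (simp add: laplacian_def minus_ell2.rep_eq scaleR_ell2.rep_eq site_convolution)
qed

lemma norm_laplacian_le: "norm (laplacian f) \<le> 4 * mass * norm f"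
proof -
  have "norm (laplacian f) \<le> norm ((2 * mass) *\<^sub>R f) + norm (convolution f)"
    unfolding laplacian_def by (rule norm_triangle_ineq4)
  then show ?thesis
    using norm_convolution_le[of f] mass_nonneg by simp
qed

lemma bounded_linear_laplacian: "bounded_linear laplacian"
  unfolding laplacian_def
  by (intro bounded_linear_sub bounded_linear_scaleR_right bounded_linear_convolution)

lemma laplacian_self_adjoint:
  fixes f g :: "'a::{real_inner,banach} ell2"
  shows "inner (laplacian f) g = inner f (laplacian g)"
  by (simp add: laplacian_def inner_diff_left inner_diff_right convolution_self_adjoint)

lemma abs_inner_laplacian_le:
  fixes f :: "'a::{real_inner,banach} ell2"
  shows "\<bar>inner (laplacian f) f\<bar> \<le> 4 * mass * (norm f)\<^sup>2"
proof -
  have "\<bar>inner (laplacian f) f\<bar> \<le> norm (laplacian f) * norm f"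
    by (rule Cauchy_Schwarz_ineq2)
  also have "\<dots> \<le> 4 * mass * norm f * norm f"
    by (intro mult_right_mono norm_laplacian_le) auto
  finally show ?thesis by (simp add: power2_eq_square mult.assoc)
qed

end

subsection \<open>Distance of the profiles from the Kronecker delta\<close>

text \<open>Convergence of the rescaled kernel gives an eventual bound by a multiple of n to the
  power -(1 + \<alpha>), a convergent series since \<alpha> > 0.\<close>

lemma alpha_kernel_imp_summable_kernel:
  assumes "alpha_kernel \<alpha> J"
  shows "summable_kernel J"
proof
  obtain l where \<alpha>: "0 < \<alpha>" and l: "(\<lambda>n. real n powr (1 + \<alpha>) * J n) \<longlonglongrightarrow> l"
    using assms by (auto simp: alpha_kernel_def)
  show nonneg: "0 \<le> J n" if "1 \<le> n" for n
    using assms that by (auto simp: alpha_kernel_def)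
  have "\<forall>\<^sub>F n in sequentially. real n powr (1 + \<alpha>) * J n < l + 1"
    by (rule order_tendstoD(2)[OF l]) simp
  then have "\<forall>\<^sub>F n in sequentially. norm (J n) \<le> (l + 1) * real n powr (- (1 + \<alpha>))"
    using eventually_ge_at_top[of 1]
  proof eventually_elim
    case (elim n)
    define x where "x = real n powr (1 + \<alpha>)"
    have "0 < x" "x * J n < l + 1" using elim by (simp_all add: x_def)
    then have "J n \<le> (l + 1) / x" by (simp add: field_simps)
    then show ?case
      using nonneg[OF elim(2)] by (simp only: powr_minus_divide x_def[symmetric]) simp
  qed
  moreover have "summable (\<lambda>n. (l + 1) * real n powr (- (1 + \<alpha>)))"
    using \<alpha> by (intro summable_mult) (simp add: summable_real_powr_iff)
  ultimately have "summable (\<lambda>n. norm (J n))"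
    using summable_comparison_test_ev[of "\<lambda>n. norm (J n)"] by simp
  then have "J summable_on UNIV"
    by (rule norm_summable_imp_summable_on)
  then show "J summable_on {1..}"
    by (rule summable_on_subset) simp
qed

context summable_kernel
begin

text \<open>With \<open>h\<close> the deviation from the delta, the local part of the equation
  factors as (1 + h)(2 + h)h at the centre and (h^2 - 1)h elsewhere. For |h| at most 1/2 the
  cofactor of h has modulus at least 3/4, so \<open>h\<close> is controlled by \<rho> times the
  operator. Since the norm of \<open>f\<close> is at most 3/2, the constant is (4/3) * 4 * (3/2) =
  8.\<close>

lemma stationary_dist_delta0_le:
  assumes eq: "\<And>n. site f n + \<rho> * nonlocal_op J (site f) n - (site f n) ^ 3 = 0"
    and \<rho>: "0 \<le> \<rho>" and near: "norm (f - delta0 1) \<le> 1 / 2"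
  shows "norm (f - delta0 1) \<le> 8 * (\<rho> * mass)"
proof -
  have "norm ((3/4) *\<^sub>R (f - delta0 1)) \<le> norm (\<rho> *\<^sub>R laplacian f)"
  proof (rule norm_ell2_mono)
    fix n
    define h where "h = site (f - delta0 1) n"
    have h: "\<bar>h\<bar> \<le> 1 / 2"
      using norm_site_le[of "f - delta0 1" n] near by (simp add: h_def)
    have "3 / 4 * \<bar>h\<bar> \<le> \<bar>\<rho> * nonlocal_op J (site f) n\<bar>"
    proof (cases "n = 0")
      case True
      then have f: "site f n = 1 + h"
        by (simp add: h_def minus_ell2.rep_eq delta0.rep_eq)
      have "1 / 2 * (3 / 2) \<le> (1 + h) * (2 + h)"
        using h by (intro mult_mono) auto
      then have "3 / 4 * \<bar>h\<bar> \<le> ((1 + h) * (2 + h)) * \<bar>h\<bar>"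
        by (intro mult_right_mono) auto
      also have "\<dots> = \<bar>(1 + h) * (2 + h) * h\<bar>"
        using h by (simp add: abs_mult)
      also have "(1 + h) * (2 + h) * h = \<rho> * nonlocal_op J (site f) n"
        using eq[of n] unfolding f by (simp add: algebra_simps power3_eq_cube)
      finally show ?thesis .
    next
      case False
      then have f: "site f n = h"
        by (simp add: h_def minus_ell2.rep_eq delta0.rep_eq)
      have "h\<^sup>2 \<le> 1 / 4"
        using abs_le_square_iff[of h "1/2"] h by (simp add: power_divide)
      then have "3 / 4 * \<bar>h\<bar> \<le> \<bar>h\<^sup>2 - 1\<bar> * \<bar>h\<bar>"
        by (intro mult_right_mono) auto
      also have "\<dots> = \<bar>(h\<^sup>2 - 1) * h\<bar>"
        by (simp add: abs_mult)
      also have "(h\<^sup>2 - 1) * h = \<rho> * nonlocal_op J (site f) n"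
        using eq[of n] unfolding f by (simp add: algebra_simps power3_eq_cube power2_eq_square)
      finally show ?thesis .
    qed
    then show "norm (site ((3/4) *\<^sub>R (f - delta0 1)) n) \<le> norm (site (\<rho> *\<^sub>R laplacian f) n)"
      by (simp add: scaleR_ell2.rep_eq site_laplacian abs_mult flip: h_def)
  qed
  then have 1: "3 / 4 * norm (f - delta0 1) \<le> \<rho> * norm (laplacian f)"
    using \<rho> by simp
  have "norm f \<le> norm (f - delta0 1) + norm (delta0 (1::real))"
    using norm_triangle_ineq[of "f - delta0 1" "delta0 1"] by simp
  then have "norm f \<le> 3 / 2" using near by simp
  then have "4 * mass * norm f \<le> 4 * mass * (3 / 2)"
    by (intro mult_left_mono) (simp_all add: mass_nonneg)
  then have "norm (laplacian f) \<le> 6 * mass"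
    using norm_laplacian_le[of f] by simp
  then have "\<rho> * norm (laplacian f) \<le> \<rho> * (6 * mass)"
    by (rule mult_left_mono[OF _ \<rho>])
  with 1 show ?thesis by simp
qed

text \<open>Continuity argument: the distance starts at 0, and if it reached 1/2 at some
  \<open>s\<close>, the previous bound would force it strictly below 1/2 there.\<close>

lemma onsite_curve_dist_delta0_le:
  assumes Q: "onsite_curve J r Q" and \<rho>: "0 \<le> \<rho>" "\<rho> < r" "\<rho> * mass < 1 / 16"
  shows "norm (Q \<rho> - delta0 1) \<le> 8 * (\<rho> * mass)"
proof -
  have bound: "norm (Q s - delta0 1) \<le> 8 * (s * mass)"
    if "0 \<le> s" "s < r" "norm (Q s - delta0 1) \<le> 1 / 2" for s
    using Q that by (intro stationary_dist_delta0_le) (auto simp: onsite_curve_def)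
  have Q0: "Q 0 = delta0 1"
    using Q by (intro ell2_eqI) (simp add: onsite_curve_def delta0.rep_eq)
  have "continuous_on {0..<r} Q"
    using Q unfolding onsite_curve_def continuous_on_eq_continuous_within
    by (meson has_vector_derivative_continuous)
  then have cont: "continuous_on {0..\<rho>} (\<lambda>s. norm (Q s - delta0 1))"
    using \<rho> by (intro continuous_intros) (auto elim: continuous_on_subset)
  have "norm (Q \<rho> - delta0 1) \<le> 1 / 2"
  proof (rule ccontr)
    assume "\<not> ?thesis"
    then obtain s where s: "0 \<le> s" "s \<le> \<rho>" "norm (Q s - delta0 1) = 1 / 2"
      using IVT'[of "\<lambda>s. norm (Q s - delta0 1)" 0 "1/2" \<rho>] cont \<rho> Q0 by auto
    have "s * mass \<le> \<rho> * mass"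
      using s mass_nonneg by (intro mult_right_mono) auto
    then show False
      using bound[of s] s \<rho> by simp
  qed
  then show ?thesis using bound \<rho> by simp
qed

section \<open>Smallness of the approximate profile away from the centre\<close>

lemma sum_inj_le_mass:
  assumes "finite F" "inj_on h F" "\<And>n. n \<in> F \<Longrightarrow> 1 \<le> h n"
  shows "(\<Sum>n\<in>F. J (h n)) \<le> mass"
proof -
  have "(\<Sum>n\<in>F. J (h n)) = sum J (h ` F)"
    by (simp add: sum.reindex[OF assms(2)])
  also have "\<dots> \<le> mass"
    unfolding total_mass_def
    by (rule finite_sum_le_infsum[OF summable]) (use assms in \<open>auto intro: nonneg\<close>)
  finally show ?thesis .
qed

text \<open>An l1 estimate by absorption: after exchanging the sums each \<open>p m\<close> carries
  total weight at most \<open>2 * mass\<close>, so the sum reappears on the right with factor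
  \<open>2 * (\<rho> * mass)\<close> and is moved to the left.\<close>

lemma sum_profile_le:
  fixes p :: "nat \<Rightarrow> real"
  assumes \<rho>: "0 \<le> \<rho>" and p: "\<And>n. 0 \<le> p n"
    and rec: "\<And>n. 1 \<le> n \<Longrightarrow> p n \<le> \<rho> * (J n * p 0 + (\<Sum>m = 1..<n. (J (n - m) + J (n + m)) * p m))"
  shows "(1 - 2 * (\<rho> * mass)) * (\<Sum>n = 1..N. p n) \<le> \<rho> * mass * p 0"
proof -
  \<comment> \<open>The triangular range is rewritten as a restriction of a fixed square, the form
    in which the two sums can be exchanged.\<close>
  have "(\<Sum>n = 1..N. \<Sum>m = 1..<n. (J (n - m) + J (n + m)) * p m)
      = (\<Sum>n = 1..N. \<Sum>m | m \<in> {1..N} \<and> m < n. (J (n - m) + J (n + m)) * p m)"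
    by (intro sum.cong refl) auto
  also have "\<dots> = (\<Sum>m = 1..N. \<Sum>n | n \<in> {1..N} \<and> m < n. (J (n - m) + J (n + m)) * p m)"
    by (rule sum.swap_restrict) auto
  also have "\<dots> \<le> (\<Sum>m = 1..N. 2 * mass * p m)"
  proof (rule sum_mono)
    fix m assume "m \<in> {1..N}"
    have "(\<Sum>n | n \<in> {1..N} \<and> m < n. J (n - m)) \<le> mass"
      by (rule sum_inj_le_mass) (auto simp: inj_on_def)
    moreover have "(\<Sum>n | n \<in> {1..N} \<and> m < n. J (n + m)) \<le> mass"
      by (rule sum_inj_le_mass) (auto simp: inj_on_def)
    ultimately have "(\<Sum>n | n \<in> {1..N} \<and> m < n. J (n - m) + J (n + m)) \<le> 2 * mass"
      by (simp add: sum.distrib)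
    then show "(\<Sum>n | n \<in> {1..N} \<and> m < n. (J (n - m) + J (n + m)) * p m) \<le> 2 * mass * p m"
      unfolding sum_distrib_right[symmetric] by (rule mult_right_mono[OF _ p])
  qed
  finally have 1: "(\<Sum>n = 1..N. \<Sum>m = 1..<n. (J (n - m) + J (n + m)) * p m)
      \<le> 2 * mass * (\<Sum>n = 1..N. p n)"
    by (simp add: sum_distrib_left)
  have "(\<Sum>n = 1..N. J n) \<le> mass"
    using sum_inj_le_mass[of "{1..N}" id] by auto
  then have 2: "(\<Sum>n = 1..N. J n * p 0) \<le> mass * p 0"
    unfolding sum_distrib_right[symmetric] by (rule mult_right_mono[OF _ p])
  have "(\<Sum>n = 1..N. p n)
      \<le> (\<Sum>n = 1..N. \<rho> * (J n * p 0 + (\<Sum>m = 1..<n. (J (n - m) + J (n + m)) * p m)))"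
    by (intro sum_mono rec) auto
  also have "\<dots> = \<rho> * ((\<Sum>n = 1..N. J n * p 0)
      + (\<Sum>n = 1..N. \<Sum>m = 1..<n. (J (n - m) + J (n + m)) * p m))"
    by (simp add: sum.distrib flip: sum_distrib_left)
  also have "\<dots> \<le> \<rho> * (mass * p 0 + 2 * mass * (\<Sum>n = 1..N. p n))"
    by (intro mult_left_mono add_mono 1 2 \<rho>)
  finally show ?thesis by (simp add: algebra_simps)
qed

text \<open>Strong induction; the denominator is positive because \<open>J (2 * n)\<close> is at
  most \<open>mass\<close>.\<close>

lemma q_rec_nonneg:
  assumes "0 < \<omega>" "0 \<le> \<epsilon>"
  shows "0 \<le> q_rec J \<epsilon> \<omega> n"
proof (induction n rule: less_induct)
  case (less n)
  show ?case
  proof (cases "n = 0")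
    case True
    then show ?thesis
      using assms mass_nonneg by (simp add: q_rec.simps[of _ _ _ 0])
  next
    case False
    have "J (2 * n) \<le> mass"
      using sum_inj_le_mass[of "{2 * n}" id] False by simp
    then have "0 \<le> 2 * mass - J (2 * n)"
      using mass_nonneg by linarith
    moreover have "0 \<le> (\<Sum>m = 1..<n. (J (n - m) + J (n + m)) * q_rec J \<epsilon> \<omega> m)"
      by (intro sum_nonneg mult_nonneg_nonneg add_nonneg_nonneg nonneg) (auto intro: less)
    ultimately show ?thesis
      using False assms less nonneg[of n] by (subst q_rec.simps) simp
  qed
qed

lemma q_rec_le:
  assumes \<omega>: "0 < \<omega>" and \<epsilon>: "0 \<le> \<epsilon>" and n: "1 \<le> n"
  shows "q_rec J \<epsilon> \<omega> n \<le> \<epsilon> / \<omega> *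
    (J n * q_rec J \<epsilon> \<omega> 0 + (\<Sum>m = 1..<n. (J (n - m) + J (n + m)) * q_rec J \<epsilon> \<omega> m))"
proof -
  let ?X = "J n * q_rec J \<epsilon> \<omega> 0 + (\<Sum>m = 1..<n. (J (n - m) + J (n + m)) * q_rec J \<epsilon> \<omega> m)"
  have "J (2 * n) \<le> mass"
    using sum_inj_le_mass[of "{2 * n}" id] n by simp
  then have D: "0 \<le> \<epsilon> * (2 * mass - J (2 * n))"
    using mass_nonneg \<epsilon> by simp
  have "0 \<le> ?X"
    using n by (intro add_nonneg_nonneg sum_nonneg mult_nonneg_nonneg nonneg q_rec_nonneg \<omega> \<epsilon>) auto
  then have "\<epsilon> * ?X / (\<epsilon> * (2 * mass - J (2 * n)) + \<omega>) \<le> \<epsilon> * ?X / \<omega>"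
    using D \<omega> \<epsilon> by (intro divide_left_mono) auto
  then show ?thesis
    using n by (subst q_rec.simps) simp
qed

lemma approx_profile_0_power2:
  assumes \<omega>: "0 < \<omega>" and \<epsilon>: "0 \<le> \<epsilon>"
  shows "(approx_profile J \<epsilon> \<omega> 0)\<^sup>2 = 1 + 2 * (\<epsilon> / \<omega> * mass)"
proof -
  have "(\<omega> powr (- 1 / 2))\<^sup>2 = 1 / \<omega>"
    using \<omega> by (simp add: power2_eq_square powr_minus_divide flip: powr_add)
  moreover have "(q_rec J \<epsilon> \<omega> 0)\<^sup>2 = \<omega> + 2 * \<epsilon> * mass"
    using \<omega> \<epsilon> mass_nonneg by (simp add: q_rec.simps[of _ _ _ 0])
  ultimately show ?thesis
    using \<omega> by (simp add: approx_profile_def power_mult_distrib field_simps)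
qed

lemma norm_off0_approx_profile_le:
  fixes f :: "complex ell2"
  assumes \<omega>: "0 < \<omega>" and \<epsilon>: "0 \<le> \<epsilon>" and small: "\<epsilon> / \<omega> * mass \<le> 1 / 16"
    and f: "\<And>n. site f n = complex_of_real (approx_profile J \<epsilon> \<omega> n)"
  shows "norm (off0 f) \<le> 3 * (\<epsilon> / \<omega> * mass)"
proof -
  define c where "c = \<epsilon> / \<omega> * mass"
  have c: "0 \<le> c" "c \<le> 1 / 16"
    using small \<omega> \<epsilon> mass_nonneg by (auto simp: c_def)
  define p where "p n = \<omega> powr (- 1 / 2) * q_rec J \<epsilon> \<omega> n" for n
  have p_nonneg: "0 \<le> p n" for n
    by (simp add: p_def q_rec_nonneg \<omega> \<epsilon>)
  have "(p 0)\<^sup>2 = 1 + 2 * c"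
    using approx_profile_0_power2[OF \<omega> \<epsilon>] by (simp add: p_def approx_profile_def c_def)
  also have "\<dots> \<le> (1 + c)\<^sup>2"
    by (simp add: power2_eq_square algebra_simps)
  finally have "p 0 \<le> 1 + c"
    by (rule power2_le_imp_le) (use c in simp)
  then have p0: "p 0 \<le> 17 / 16" using c by simp
  \<comment> \<open>The factor 2 accounts for the two mirror halves. Since \<open>1 - 2 * c\<close>
    is at least 7/8 and \<open>p 0\<close> at most 17/16, the doubled sum is at most
    (17/7)c.\<close>
  have sum_p: "2 * (\<Sum>n = 1..N. p n) \<le> 3 * c" for N
  proof -
    have "(1 - 2 * c) * (\<Sum>n = 1..N. p n) \<le> c * p 0"
      unfolding c_def
    proof (rule sum_profile_le)
      show "p n \<le> \<epsilon> / \<omega> * (J n * p 0 + (\<Sum>m = 1..<n. (J (n - m) + J (n + m)) * p m))"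
        if "1 \<le> n" for n
        using mult_left_mono[OF q_rec_le[OF \<omega> \<epsilon> that], of "\<omega> powr (- 1 / 2)"]
        by (simp add: p_def sum_distrib_left algebra_simps)
    qed (use \<omega> \<epsilon> p_nonneg in auto)
    moreover have "7 / 8 * (\<Sum>n = 1..N. p n) \<le> (1 - 2 * c) * (\<Sum>n = 1..N. p n)"
      using c by (intro mult_right_mono sum_nonneg p_nonneg) auto
    moreover have "c * p 0 \<le> c * (17 / 16)"
      by (rule mult_left_mono[OF p0 c(1)])
    ultimately show ?thesis using c by linarith
  qed
  have "norm (off0 f) \<le> 3 * c"
    unfolding norm_ell2.rep_eq
  proof (rule sq_summable_and_norm_le(2))
    fix F :: "int set" assume F: "finite F"
    \<comment> \<open>A crude bound on all indices in \<open>F\<close> that also covers empty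
      \<open>F\<close>. It places \<open>F - {0}\<close> inside two mirror copies of
      \<open>{1..N}\<close>, where the l1 bound applies.\<close>
    define N where "N = nat (\<Sum>n\<in>F. \<bar>n\<bar>)"
    have N: "\<bar>n\<bar> \<le> int N" if "n \<in> F" for n
      using member_le_sum[OF that, of abs] F by (simp add: N_def)
    have site: "norm (site (off0 f) n) = (if n = 0 then 0 else p (nat \<bar>n\<bar>))" for n
      by (simp add: site_off0 f approx_profile_def norm_mult p_def q_rec_nonneg \<omega> \<epsilon>)
    have "L2_set (\<lambda>n. norm (site (off0 f) n)) F \<le> (\<Sum>n\<in>F. norm (site (off0 f) n))"
      by (rule L2_set_le_sum) simp
    also have "\<dots> = (\<Sum>n\<in>F - {0}. p (nat \<bar>n\<bar>))"
      unfolding site using F by (intro sum.mono_neutral_cong_right) auto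
    also have "\<dots> \<le> (\<Sum>n\<in>int ` {1..N} \<union> (\<lambda>n. - int n) ` {1..N}. p (nat \<bar>n\<bar>))"
    proof (rule sum_mono2)
      show "F - {0} \<subseteq> int ` {1..N} \<union> (\<lambda>n. - int n) ` {1..N}"
      proof
        fix n assume n: "n \<in> F - {0}"
        then have "nat \<bar>n\<bar> \<in> {1..N}" using N[of n] by auto
        moreover have "n = int (nat \<bar>n\<bar>) \<or> n = - int (nat \<bar>n\<bar>)" by auto
        ultimately show "n \<in> int ` {1..N} \<union> (\<lambda>n. - int n) ` {1..N}" by blast
      qed
    qed (auto simp: p_nonneg)
    also have "\<dots> = (\<Sum>n\<in>int ` {1..N}. p (nat \<bar>n\<bar>)) + (\<Sum>n\<in>(\<lambda>n. - int n) ` {1..N}. p (nat \<bar>n\<bar>))"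
      by (rule sum.union_disjoint) auto
    also have "\<dots> = 2 * (\<Sum>n = 1..N. p n)"
      by (simp add: sum.reindex inj_on_def)
    finally show "L2_set (\<lambda>n. norm (site (off0 f) n)) F \<le> 3 * c"
      using sum_p[of N] by simp
  qed
  then show ?thesis by (simp add: c_def)
qed

end

subsection \<open>Conservation laws and localization\<close>

lemma bounded_linear_site: "bounded_linear (\<lambda>f. site f n)"
  by (rule bounded_linear_intro[where K = 1])
     (simp_all add: plus_ell2.rep_eq scaleR_ell2.rep_eq norm_site_le)

lift_definition times_i :: "complex ell2 \<Rightarrow> complex ell2" is "\<lambda>f n. \<i> * f n"
  by (simp add: sq_summable_def norm_mult)

context summable_kernel
begin

lemma laplacian_times_i: "laplacian (times_i f) = times_i (laplacian f)"
  by (rule ell2_eqI)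
     (simp add: site_laplacian times_i.rep_eq nonlocal_op_def
       flip: infsum_cmult_right' right_diff_distrib mult_scaleR_right)

text \<open>\<open>times_i\<close> is antisymmetric and commutes with the self-adjoint
  \<open>laplacian\<close>, so the quantity equals its own negative.\<close>

lemma inner_times_i_laplacian: "inner (times_i f) (laplacian f) = 0"
proof -
  have anti: "inner (times_i g) f = - inner g (times_i f)" for g f
    by (simp add: inner_ell2.rep_eq times_i.rep_eq inner_complex_def flip: infsum_uminus)
  have "inner (times_i f) (laplacian f) = inner (times_i (laplacian f)) f"
    by (simp flip: laplacian_self_adjoint laplacian_times_i)
  then show ?thesis
    using anti[of "laplacian f" f] by (simp add: inner_commute)
qed

text \<open>The cubic term drops out site by site, since i z is orthogonal to any real multiple of
  z; the linear term vanishes after summation by \<open>inner_times_i_laplacian\<close>.\<close>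

lemma dnls_norm_const:
  assumes u: "dnls_solution J \<rho> u"
  shows "norm (u t) = norm (u 0)"
proof -
  have "((\<lambda>t. inner (u t) (u t)) has_real_derivative 0) (at t)" for t
  proof -
    obtain v where v: "(u has_vector_derivative v) (at t)" and
      eq: "\<And>n. \<i> * site v n = complex_of_real \<rho> * site (laplacian (u t)) n
               - complex_of_real ((cmod (site (u t) n))\<^sup>2) * site (u t) n"
      using u unfolding dnls_solution_def site_laplacian by meson
    have "inner (site (u t) n) (site v n)
        = \<rho> * inner (site (times_i (u t)) n) (site (laplacian (u t)) n)" for n
    proof -
      \<comment> \<open>Multiplying both arguments by i preserves the inner product and exposes the
        left side of the evolution equation.\<close>
      have "inner (site (u t) n) (site v n) = inner (\<i> * site (u t) n) (\<i> * site v n)"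
        by (simp add: inner_complex_def)
      also have "\<dots> = \<rho> * inner (site (times_i (u t)) n) (site (laplacian (u t)) n)"
        unfolding eq by (simp add: inner_complex_def times_i.rep_eq algebra_simps)
      finally show ?thesis .
    qed
    then have "inner (u t) v = \<rho> * inner (times_i (u t)) (laplacian (u t))"
      by (simp add: inner_ell2.rep_eq infsum_cmult_right')
    then have "inner (u t) v = 0"
      by (simp add: inner_times_i_laplacian)
    then show ?thesis
      using bounded_bilinear.has_vector_derivative[OF bounded_bilinear_inner v v]
      by (simp add: has_real_derivative_iff_has_vector_derivative inner_commute)
  qed
  then have "inner (u t) (u t) = inner (u 0) (u 0)"
    by (intro DERIV_isconst_all) auto
  then show ?thesis by (simp add: norm_eq_sqrt_inner)
qed

text \<open>Four times the usual Hamiltonian, so that the quartic sum has coefficient -1.\<close>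

definition energy :: "real \<Rightarrow> complex ell2 \<Rightarrow> real" where
  "energy \<rho> f = 2 * \<rho> * inner (laplacian f) f - (norm (pointwise_inner f f))\<^sup>2"

text \<open>Pairing the equation with the time derivative \<open>v\<close> kills the left side, as i
  v is orthogonal to v. The remaining identity balances the derivatives of the two energy
  terms.\<close>

lemma dnls_energy_const:
  assumes u: "dnls_solution J \<rho> u"
  shows "energy \<rho> (u t) = energy \<rho> (u 0)"
proof -
  have "((\<lambda>t. energy \<rho> (u t)) has_real_derivative 0) (at t)" for t
  proof -
    obtain v where v: "(u has_vector_derivative v) (at t)" and
      eq: "\<And>n. \<i> * site v n = complex_of_real \<rho> * site (laplacian (u t)) n
               - complex_of_real ((cmod (site (u t) n))\<^sup>2) * site (u t) n"
      using u unfolding dnls_solution_def site_laplacian by meson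
    have "\<rho> * inner (site (laplacian (u t)) n) (site v n)
        = inner (site (pointwise_inner (u t) (u t)) n) (site (pointwise_inner (u t) v) n)" for n
    proof -
      have "\<rho> * inner (site (laplacian (u t)) n) (site v n)
          - (cmod (site (u t) n))\<^sup>2 * inner (site (u t) n) (site v n)
          = inner (\<i> * site v n) (site v n)"
        unfolding eq by (simp add: inner_complex_def algebra_simps)
      also have "\<dots> = 0"
        by (simp add: inner_complex_def)
      finally show ?thesis
        by (simp add: pointwise_inner.rep_eq power2_norm_eq_inner)
    qed
    then have \<rho>: "\<rho> * inner (laplacian (u t)) v
        = inner (pointwise_inner (u t) (u t)) (pointwise_inner (u t) v)"
      by (simp add: inner_ell2.rep_eq flip: infsum_cmult_right')
    have comm: "pointwise_inner v (u t) = pointwise_inner (u t) v"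
      by (rule ell2_eqI) (simp add: pointwise_inner.rep_eq inner_commute)
    note L = bounded_linear.has_vector_derivative[OF bounded_linear_laplacian v]
    note B = bounded_bilinear.has_vector_derivative[OF bounded_bilinear_pointwise_inner v v]
    have "inner (laplacian v) (u t) = inner (laplacian (u t)) v"
      by (metis laplacian_self_adjoint inner_commute)
    then have "((\<lambda>t. inner (laplacian (u t)) (u t)) has_real_derivative
        2 * inner (laplacian (u t)) v) (at t)"
      using bounded_bilinear.has_vector_derivative[OF bounded_bilinear_inner L v]
      by (simp add: has_real_derivative_iff_has_vector_derivative)
    moreover have "((\<lambda>t. (norm (pointwise_inner (u t) (u t)))\<^sup>2) has_real_derivative
        4 * inner (pointwise_inner (u t) (u t)) (pointwise_inner (u t) v)) (at t)"
      using bounded_bilinear.has_vector_derivative[OF bounded_bilinear_inner B B]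
      by (simp add: has_real_derivative_iff_has_vector_derivative power2_norm_eq_inner
          inner_add_right inner_add_left comm inner_commute)
    ultimately have "((\<lambda>t. energy \<rho> (u t)) has_real_derivative
        2 * \<rho> * (2 * inner (laplacian (u t)) v)
        - 4 * inner (pointwise_inner (u t) (u t)) (pointwise_inner (u t) v)) (at t)"
      unfolding energy_def by (intro DERIV_diff DERIV_cmult)
    then show ?thesis by (simp flip: \<rho>)
  qed
  then show ?thesis
    by (intro DERIV_isconst_all) auto
qed

text \<open>By energy conservation the quartic sum changes only by \<rho> times twice the change of
  the quadratic form, whose values are bounded by 4 \<open>mass\<close> times the conserved squared
  norm; hence 2 * (4 + 4) = 16.\<close>

lemma norm_pointwise_inner_power2_ge:
  assumes u: "dnls_solution J \<rho> u" and \<rho>: "0 \<le> \<rho>"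
  shows "(norm (pointwise_inner (u t) (u t)))\<^sup>2
    \<ge> (norm (pointwise_inner (u 0) (u 0)))\<^sup>2 - 16 * (\<rho> * mass) * (norm (u 0))\<^sup>2"
proof -
  have "\<bar>inner (laplacian (u s)) (u s)\<bar> \<le> 4 * mass * (norm (u 0))\<^sup>2" for s
    using abs_inner_laplacian_le[of "u s"] dnls_norm_const[OF u] by metis
  from this[of 0] this[of t] have "\<rho> * (inner (laplacian (u 0)) (u 0) - inner (laplacian (u t)) (u t))
      \<le> \<rho> * (8 * mass * (norm (u 0))\<^sup>2)"
    by (intro mult_left_mono[OF _ \<rho>]) linarith
  then show ?thesis
    using dnls_energy_const[OF u, of t] by (simp add: energy_def algebra_simps)
qed

lemma dnls_onsite_localization:
  assumes u: "dnls_solution J \<rho> u" and \<rho>: "0 \<le> \<rho>"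
    and c: "c = \<rho> * mass" "c \<le> 1 / 64"
    and u0: "(norm (site (u 0) 0))\<^sup>2 = 1 + 2 * c" "norm (off0 (u 0)) \<le> 3 * c"
  shows "(norm (off0 (u t)))\<^sup>2 \<le> 27 * c" "\<bar>norm (site (u t) 0) - 1\<bar> \<le> 27 * c"
proof -
  define X where "X t = (norm (site (u t) 0))\<^sup>2" for t
  define Y where "Y t = (norm (off0 (u t)))\<^sup>2" for t
  define N where "N = (norm (u 0))\<^sup>2"
  have c0: "0 \<le> c" using \<rho> mass_nonneg by (simp add: c)
  \<comment> \<open>Used below to absorb every quadratic remainder into a linear one.\<close>
  have c2: "9 * c\<^sup>2 \<le> c"
    using mult_right_mono[OF c(2) c0] c0 by (simp add: power2_eq_square)
  have XY: "X t + Y t = N" for t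
    using norm_split_site0[of "u t"] dnls_norm_const[OF u, of t] by (simp add: X_def Y_def N_def)
  have nonneg: "0 \<le> X t" "0 \<le> Y t" for t
    by (simp_all add: X_def Y_def)
  have X0: "X 0 = 1 + 2 * c" using u0 by (simp add: X_def)
  have "Y 0 \<le> 9 * c\<^sup>2"
    using power_mono[OF u0(2), of 2] by (simp add: Y_def power_mult_distrib)
  then have N: "1 \<le> N" "N \<le> 1 + 3 * c" and Y0: "Y 0 < X 0"
    using XY[of 0] X0 nonneg[of 0] c2 c0 c(2) by auto
  \<comment> \<open>Comparing the quartic sums gives at most (1 + 3c)^2 - (1 + 2c)^2 + 16c(1 + 3c) =
    18c + 53c^2, which is below 27c because 9c^2 is at most c.\<close>
  have prod: "2 * (X t * Y t) \<le> 27 * c" for t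
  proof -
    have "norm (site (pointwise_inner (u 0) (u 0)) 0) \<le> norm (pointwise_inner (u 0) (u 0))"
      by (rule norm_site_le)
    then have "1 + 2 * c \<le> norm (pointwise_inner (u 0) (u 0))"
      using u0 c0 by (simp add: pointwise_inner.rep_eq power2_norm_eq_inner)
    then have "(1 + 2 * c)\<^sup>2 \<le> (norm (pointwise_inner (u 0) (u 0)))\<^sup>2"
      using c0 by (intro power_mono) auto
    also have "\<dots> \<le> (norm (pointwise_inner (u t) (u t)))\<^sup>2 + 16 * c * N"
      using norm_pointwise_inner_power2_ge[OF u \<rho>, of t] by (simp add: c N_def)
    also have "\<dots> \<le> (X t)\<^sup>2 + (Y t)\<^sup>2 + 16 * c * N"
      using norm_pointwise_inner_split_le[of "u t"] by (simp add: X_def Y_def)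
    finally have "(1 + 2 * c)\<^sup>2 \<le> (X t)\<^sup>2 + (Y t)\<^sup>2 + 16 * c * N" .
    moreover have "(X t)\<^sup>2 + (Y t)\<^sup>2 + 2 * (X t * Y t) = N\<^sup>2"
      unfolding XY[of t, symmetric] by (simp add: power2_eq_square algebra_simps)
    moreover have "N\<^sup>2 \<le> (1 + 3 * c)\<^sup>2"
      using N by (intro power_mono) auto
    moreover have "16 * c * N \<le> 16 * c * (1 + 3 * c)"
      using N c0 by (intro mult_left_mono) auto
    ultimately show ?thesis
      using c2 c0 by (simp add: power2_eq_square algebra_simps)
  qed
  have "continuous_on UNIV u"
    using u unfolding dnls_solution_def continuous_on_eq_continuous_at[OF open_UNIV]
    by (meson has_vector_derivative_continuous)
  then have "continuous_on UNIV X"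
    unfolding X_def
    by (intro continuous_intros bounded_linear.continuous_on[OF bounded_linear_site])
  then have conn: "connected (range X)"
    by (rule connected_continuous_image) simp
  \<comment> \<open>\<open>X\<close> starts above N/2. A crossing would make the doubled product
    N^2/2, hence at least 1/2, whereas 27c is at most 27/64.\<close>
  have gt: "N < 2 * X t" for t
  proof (rule ccontr)
    assume "\<not> ?thesis"
    moreover have "N < 2 * X 0" using XY[of 0] Y0 by simp
    ultimately have "N / 2 \<in> range X"
      using connected_contains_Icc[OF conn, of "X t" "X 0"] by auto
    then obtain s where s: "X s = N / 2" by auto
    have Ys: "Y s = N / 2" using XY[of s] s by simp
    have "2 * (X s * Y s) = N\<^sup>2 / 2"
      unfolding s Ys by (simp add: power2_eq_square)
    moreover have "1 \<le> N\<^sup>2" using N by simp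
    ultimately show False
      using prod[of s] c by simp
  qed
  have Y: "Y t \<le> 27 * c"
  proof -
    \<comment> \<open>Since N is at least 1, the factor \<open>2 * X t\<close> exceeds 1, so the
      product bound becomes a bound on \<open>Y t\<close> alone.\<close>
    have "1 * Y t \<le> (2 * X t) * Y t"
      using gt[of t] N nonneg by (intro mult_right_mono) auto
    then show ?thesis using prod[of t] by simp
  qed
  then show "(norm (off0 (u t)))\<^sup>2 \<le> 27 * c" by (simp add: Y_def)
  define x where "x = norm (site (u t) 0)"
  have x: "0 \<le> x" "x\<^sup>2 = X t" by (simp_all add: x_def X_def)
  \<comment> \<open>Passes from \<open>x\<close> to its square, where \<open>X t - 1\<close> is (N -
    1) - \<open>Y t\<close> and so lies between -27c and 3c.\<close>
  have "\<bar>x - 1\<bar> * 1 \<le> \<bar>x - 1\<bar> * (x + 1)"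
    using x by (intro mult_left_mono) auto
  also have "\<dots> = \<bar>(x - 1) * (x + 1)\<bar>"
    using x by (simp add: abs_mult)
  also have "(x - 1) * (x + 1) = X t - 1"
    by (simp add: x(2)[symmetric] power2_eq_square algebra_simps)
  also have "\<bar>X t - 1\<bar> \<le> 27 * c"
    using XY[of t] Y nonneg[of t] N c0 by auto
  finally show "\<bar>norm (site (u t) 0) - 1\<bar> \<le> 27 * c" by (simp add: x_def)
qed

text \<open>Both \<open>u t\<close> and a rotation of \<open>q\<close> are compared with the same
  rotated delta. The first distance has square at most 54c, hence is at most
  \<open>8 * sqrt c\<close>; the second is at most 8c, hence at most \<open>sqrt c\<close> because c
  is at most 1/64.\<close>

lemma dnls_orbit_dist_le:
  assumes u: "dnls_solution J \<rho> u" and \<rho>: "0 \<le> \<rho>"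
    and c: "c = \<rho> * mass" "c \<le> 1 / 64"
    and u0: "(norm (site (u 0) 0))\<^sup>2 = 1 + 2 * c" "norm (off0 (u 0)) \<le> 3 * c"
    and q: "norm (q - delta0 1) \<le> 8 * c"
  shows "\<exists>\<theta>. norm (u t - rotate_phase \<theta> q) \<le> 9 * sqrt c"
proof -
  define z where "z = site (u t) 0"
  \<comment> \<open>The phase of the central site. The polar identity below also holds for
    \<open>z = 0\<close>, and \<open>w\<close> is unimodular in every case.\<close>
  define w where "w = exp (\<i> * complex_of_real (Arg z))"
  have c0: "0 \<le> c" using \<rho> mass_nonneg by (simp add: c)
  have "z = of_real (norm z) * w"
    using Arg_eq[of z] by (cases "z = 0") (auto simp: w_def)
  then have "norm (z - w) = norm (of_real (norm z - 1) * w)"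
    by (metis of_real_diff of_real_1 left_diff_distrib mult_1)
  then have "norm (z - w) = \<bar>norm z - 1\<bar>"
    by (simp only: norm_mult norm_of_real) (simp add: w_def)
  then have zw: "norm (z - w) \<le> 27 * c"
    using dnls_onsite_localization(2)[OF u \<rho> c u0, of t] by (simp add: z_def)
  have "off0 (u t - delta0 w) = off0 (u t)"
    by (rule ell2_eqI) (simp add: site_off0 minus_ell2.rep_eq delta0.rep_eq)
  then have "(norm (u t - delta0 w))\<^sup>2 = (norm (z - w))\<^sup>2 + (norm (off0 (u t)))\<^sup>2"
    using norm_split_site0[of "u t - delta0 w"] by (simp add: minus_ell2.rep_eq delta0.rep_eq z_def)
  also have "\<dots> \<le> (27 * c)\<^sup>2 + 27 * c"
    using zw by (intro add_mono power_mono dnls_onsite_localization(1)[OF u \<rho> c u0]) auto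
  also have "(27 * c)\<^sup>2 \<le> 27 * c"
    using mult_right_mono[of "27 * c" 1 "27 * c"] c c0 by (simp add: power2_eq_square)
  finally have "(norm (u t - delta0 w))\<^sup>2 \<le> (8 * sqrt c)\<^sup>2"
    using c0 by (simp add: power_mult_distrib)
  then have 1: "norm (u t - delta0 w) \<le> 8 * sqrt c"
    by (rule power2_le_imp_le) (simp add: c0)
  have "sqrt c \<le> sqrt ((1 / 8)\<^sup>2)"
    using c(2) by (intro real_sqrt_le_mono) (simp add: power2_eq_square)
  then have "8 * (sqrt c * sqrt c) \<le> sqrt c"
    using mult_right_mono[of "sqrt c" "1 / 8" "sqrt c"] c0 by simp
  then have "8 * c \<le> sqrt c" using c0 by simp
  \<comment> \<open>Up to sign, the left sequence is \<open>q - delta0 1\<close> rotated by the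
    unimodular \<open>w\<close>.\<close>
  moreover have "norm (delta0 w - rotate_phase (Arg z) q) \<le> norm (q - delta0 1)"
  proof (rule norm_ell2_mono)
    fix n
    have "site (delta0 w - rotate_phase (Arg z) q) n = - (w * of_real (site (q - delta0 1) n))"
      by (simp add: minus_ell2.rep_eq delta0.rep_eq rotate_phase.rep_eq w_def algebra_simps)
    then show "norm (site (delta0 w - rotate_phase (Arg z) q) n) \<le> norm (site (q - delta0 1) n)"
      by (simp add: norm_mult w_def)
  qed
  ultimately have "norm (u t - rotate_phase (Arg z) q) \<le> 9 * sqrt c"
    using norm_triangle_ineq[of "u t - delta0 w" "delta0 w - rotate_phase (Arg z) q"] 1 q by simp
  then show ?thesis ..
qed

end

text \<open>\<kappa> fixes the interval on which the branch is given, as a multiple of 1/J; the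
  threshold is chosen before the kernel and depends only on \<kappa> and the tolerance. Extended
  reals give the supremum over time its true value even before boundedness is known.\<close>

theorem corollary5p3:
  fixes \<kappa> :: real
  assumes "0 < \<kappa>"
  shows "\<forall>\<epsilon>'>0. \<exists>c\<^sub>0>0. c\<^sub>0 \<le> \<kappa> \<and> c\<^sub>0 \<le> 1 / 16 \<and>
    (\<forall>(\<alpha>::real) (J::nat \<Rightarrow> real) (Q::real \<Rightarrow> real ell2) (\<epsilon>::real) (\<omega>\<^sub>A::real) (\<rho>::real)
       (u::real \<Rightarrow> complex ell2).
       alpha_kernel \<alpha> J \<longrightarrow>
       onsite_curve J (\<kappa> / total_mass J) Q \<longrightarrow>
       0 < \<omega>\<^sub>A \<longrightarrow> \<rho> = \<epsilon> / \<omega>\<^sub>A \<longrightarrow>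
       0 \<le> \<rho> \<longrightarrow> \<rho> < c\<^sub>0 / total_mass J \<longrightarrow>
       dnls_solution J \<rho> u \<longrightarrow>
       (\<forall>n. site (u 0) n = complex_of_real (approx_profile J \<epsilon> \<omega>\<^sub>A n)) \<longrightarrow>
       (SUP t::real. INF \<theta>::real. ereal (norm (u t - rotate_phase \<theta> (Q \<rho>)))) < ereal \<epsilon>')"
proof (intro allI impI)
  fix \<epsilon>' :: real assume \<epsilon>': "0 < \<epsilon>'"
  \<comment> \<open>The three bounds keep \<rho> on the given branch, allow the localization
    estimate, and make \<open>9 * sqrt c\<close> at most nine tenths of the tolerance, so strictness
    survives the supremum.\<close>
  define c\<^sub>0 where "c\<^sub>0 = min \<kappa> (min (1 / 64) ((\<epsilon>' / 10)\<^sup>2))"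
  have c\<^sub>0: "0 < c\<^sub>0" "c\<^sub>0 \<le> \<kappa>" "c\<^sub>0 \<le> 1 / 64" "c\<^sub>0 \<le> (\<epsilon>' / 10)\<^sup>2"
    using assms \<epsilon>' by (auto simp: c\<^sub>0_def)
  have "(SUP t. INF \<theta>. ereal (norm (u t - rotate_phase \<theta> (Q \<rho>)))) < ereal \<epsilon>'"
    if J: "alpha_kernel \<alpha> J" and Q: "onsite_curve J (\<kappa> / total_mass J) Q" and \<omega>: "0 < \<omega>"
      and \<rho>: "\<rho> = \<epsilon> / \<omega>" "0 \<le> \<rho>" "\<rho> < c\<^sub>0 / total_mass J" and u: "dnls_solution J \<rho> u"
      and u0: "\<forall>n. site (u 0) n = complex_of_real (approx_profile J \<epsilon> \<omega> n)"
    for \<alpha> J Q \<epsilon> \<omega> \<rho> and u :: "real \<Rightarrow> complex ell2"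
  proof -
    interpret summable_kernel J by (rule alpha_kernel_imp_summable_kernel[OF J])
    \<comment> \<open>If the mass were 0, division by zero would give 0 and \<rho> would be
      negative.\<close>
    have mass: "0 < mass"
      using \<rho> mass_nonneg by (cases "mass = 0") auto
    define c where "c = \<rho> * mass"
    have c: "c < c\<^sub>0" "0 \<le> c"
      using \<rho>(2,3) mass by (simp_all add: c_def pos_less_divide_eq)
    have \<epsilon>: "0 \<le> \<epsilon>" using \<rho> \<omega> by (simp add: zero_le_divide_iff)
    have "norm (Q \<rho> - delta0 1) \<le> 8 * (\<rho> * mass)"
    proof (rule onsite_curve_dist_delta0_le[OF Q \<rho>(2)])
      show "\<rho> < \<kappa> / mass"
        using \<rho>(3) c\<^sub>0(2) mass by (simp add: divide_right_mono less_le_trans)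
      show "\<rho> * mass < 1 / 16" using c c\<^sub>0 by (simp add: c_def)
    qed
    then have q: "norm (Q \<rho> - delta0 1) \<le> 8 * c" by (simp add: c_def)
    have u0_0: "(norm (site (u 0) 0))\<^sup>2 = 1 + 2 * c"
      using u0 approx_profile_0_power2[OF \<omega> \<epsilon>] by (simp add: c_def \<rho>(1))
    have off0: "norm (off0 (u 0)) \<le> 3 * c"
      using norm_off0_approx_profile_le[OF \<omega> \<epsilon>, of "u 0"] u0 c c\<^sub>0 by (simp add: c_def \<rho>(1))
    have "(SUP t. INF \<theta>. ereal (norm (u t - rotate_phase \<theta> (Q \<rho>)))) \<le> ereal (9 * sqrt c)"
    proof (rule SUP_least)
      fix t
      obtain \<theta> where "norm (u t - rotate_phase \<theta> (Q \<rho>)) \<le> 9 * sqrt c"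
        using dnls_orbit_dist_le[OF u \<rho>(2) c_def _ u0_0 off0 q, of t] c c\<^sub>0 by auto
      then show "(INF \<theta>. ereal (norm (u t - rotate_phase \<theta> (Q \<rho>)))) \<le> ereal (9 * sqrt c)"
        by (intro INF_lower2[of \<theta>]) auto
    qed
    also have "sqrt c \<le> sqrt ((\<epsilon>' / 10)\<^sup>2)"
      using c c\<^sub>0 by (intro real_sqrt_le_mono) simp
    then have "ereal (9 * sqrt c) < ereal \<epsilon>'"
      using \<epsilon>' by simp
    finally show ?thesis .
  qed
  then show "\<exists>c\<^sub>0>0. c\<^sub>0 \<le> \<kappa> \<and> c\<^sub>0 \<le> 1 / 16 \<and>
    (\<forall>(\<alpha>::real) (J::nat \<Rightarrow> real) (Q::real \<Rightarrow> real ell2) (\<epsilon>::real) (\<omega>\<^sub>A::real) (\<rho>::real)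
       (u::real \<Rightarrow> complex ell2).
       alpha_kernel \<alpha> J \<longrightarrow>
       onsite_curve J (\<kappa> / total_mass J) Q \<longrightarrow>
       0 < \<omega>\<^sub>A \<longrightarrow> \<rho> = \<epsilon> / \<omega>\<^sub>A \<longrightarrow>
       0 \<le> \<rho> \<longrightarrow> \<rho> < c\<^sub>0 / total_mass J \<longrightarrow>
       dnls_solution J \<rho> u \<longrightarrow>
       (\<forall>n. site (u 0) n = complex_of_real (approx_profile J \<epsilon> \<omega>\<^sub>A n)) \<longrightarrow>
       (SUP t::real. INF \<theta>::real. ereal (norm (u t - rotate_phase \<theta> (Q \<rho>)))) < ereal \<epsilon>')"
    using c\<^sub>0 by (intro exI[of _ c\<^sub>0]) auto
qed

end
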